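(* Let $u_h^\alpha\in V_h$ and $w_h^\alpha\in V_{h,0}$ be given. Then, for every fixed $\alpha_q>0$, the minimization problem \[ q_h^\alpha:=\operatorname*{argmin}_{q_h\in Q_h}\Big(\|w_h^\alpha+q_hu_h^\alpha\|_{L^2(\Omega')}^2+\alpha_q\|q_h\|_{L^2(\Omega')}^2\Big) \] has a unique minimizer $q_h^\alpha\in Q_h$. Moreover, $q_h^\alpha$ is characterized by the variational normal equations \[ \int_{\Omega'}\big((u_h^\alpha)^2+\alpha_q\big)q_h^\alpha\phi_h\,dx=-\int_{\Omega'}w_h^\alpha u_h^\alpha\phi_h\,dx\qquad\forall\phi_h\in Q_h, \] and the coefficient vector $\mathbf q=(q_1,\dots,q_{N_q})^\top$ of $q_h^\alpha=\sum_{j=1}^{N_q}q_j\psi_j$ is the unique solution of the symmetric positive definite linear system $G_\alpha\mathbf q=\mathbf b$, where \[ (G_\alpha)_{ij}=\int_{\Omega'}\big((u_h^\alpha)^2+\alpha_q\big)\psi_i\psi_j\,dx,\qquad b_i=-\int_{\Omega'}w_h^\alpha u_h^\alpha\psi_i\,dx . \]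
   Context: $\Omega\subset\mathbb{R}^d$ is a bounded Lipschitz domain, $\Omega'\subset\subset\Omega$ an interior subdomain, $\Omega_R=(-R,R)^d\supset\Omega$. $V_h\subset H^1(\Omega_R)$ is the continuous piecewise polynomial finite element space of degree $p\ge1$ on a mesh of $\Omega_R$ (so $V_h\subset L^\infty(\Omega_R)$), and $V_{h,0}=\{v_h\in V_h:v_h=0\text{ on }\Omega_R\setminus\Omega\}$. $Q_h\subset L^\infty(\Omega')\cap L^2(\Omega')$ is a finite-dimensional (finite element) space with basis $\{\psi_j\}_{j=1}^{N_q}$. *)

theory Defs
  imports "HOL-Analysis.Analysis"
begin

text \<open>
  Near every boundary point the domain is, in suitable orthogonal coordinates, the part of a ball
  lying above the graph of a Lipschitz function. The vertical axis of these coordinates is the unit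
  vector \<open>e\<close>, and the graph function \<open>\<gamma>\<close> lives on the hyperplane orthogonal to \<open>e\<close>, which plays the
  role of the space of the remaining \<open>d - 1\<close> coordinates.
\<close>

definition bounded_lipschitz_domain :: "(real^'d) set \<Rightarrow> bool" where
  "bounded_lipschitz_domain \<Omega> \<longleftrightarrow>
     open \<Omega> \<and> connected \<Omega> \<and> \<Omega> \<noteq> {} \<and> bounded \<Omega> \<and>
     (\<forall>x\<^sub>0 \<in> frontier \<Omega>. \<exists>e r \<gamma> L.
        norm e = 1 \<and> r > 0 \<and> L-lipschitz_on {y. y \<bullet> e = 0} \<gamma> \<and>
        \<Omega> \<inter> ball x\<^sub>0 r = {x \<in> ball x\<^sub>0 r. x \<bullet> e > \<gamma> (x - (x \<bullet> e) *\<^sub>R e)})"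

definition interior_subdomain :: "(real^'d) set \<Rightarrow> (real^'d) set \<Rightarrow> bool" where
  "interior_subdomain \<Omega>' \<Omega> \<longleftrightarrow>
     open \<Omega>' \<and> connected \<Omega>' \<and> \<Omega>' \<noteq> {} \<and> compact (closure \<Omega>') \<and> closure \<Omega>' \<subseteq> \<Omega>"

definition cube :: "real \<Rightarrow> (real^'d) set" where
  "cube R = {x. \<forall>i. - R < x $ i \<and> x $ i < R}"

text \<open>
  Face-to-face meshes with polytopal cells of full dimension; simplicial and hexahedral meshes are
  special cases. Since the intersection of two cells is a face of both, distinct cells have
  disjoint interiors.
\<close>

definition mesh_of :: "(real^'d) set \<Rightarrow> (real^'d) set set \<Rightarrow> bool" where
  "mesh_of D \<T> \<longleftrightarrow>
     finite \<T> \<and>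
     (\<forall>K\<in>\<T>. polytope K \<and> interior K \<noteq> {}) \<and>
     (\<forall>K\<in>\<T>. \<forall>K'\<in>\<T>. (K \<inter> K') face_of K \<and> (K \<inter> K') face_of K') \<and>
     \<Union>\<T> = closure D"

text \<open>Polynomial functions of total degree at most \<open>p\<close>; \<open>a\<close> ranges over multi-indices.\<close>

definition poly_fun :: "nat \<Rightarrow> (real^'d \<Rightarrow> real) \<Rightarrow> bool" where
  "poly_fun p f \<longleftrightarrow>
     (\<exists>c :: ('d \<Rightarrow> nat) \<Rightarrow> real. \<forall>x.
        f x = (\<Sum>a | (\<Sum>i\<in>UNIV. a i) \<le> p. c a * (\<Prod>i\<in>UNIV. (x $ i) ^ a i)))"

text \<open>
  Functions on a domain \<open>D\<close> are represented by total functions, whose values outside \<open>D\<close> are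
  irrelevant.
\<close>

definition fe_space :: "(real^'d) set \<Rightarrow> (real^'d) set set \<Rightarrow> nat \<Rightarrow> (real^'d \<Rightarrow> real) set" where
  "fe_space D \<T> p =
     {v. continuous_on D v \<and> (\<forall>K\<in>\<T>. \<exists>f. poly_fun p f \<and> (\<forall>x \<in> K \<inter> D. v x = f x))}"

definition fe_space_0 ::
  "(real^'d) set \<Rightarrow> (real^'d) set set \<Rightarrow> nat \<Rightarrow> (real^'d) set \<Rightarrow> (real^'d \<Rightarrow> real) set" where
  "fe_space_0 D \<T> p \<Omega> = {v \<in> fe_space D \<T> p. \<forall>x \<in> D - \<Omega>. v x = 0}"

text \<open>
  Elements of \<open>L\<^sup>2(S)\<close> and \<open>L\<^sup>\<infinity>(S)\<close> are represented by functions; equality in these spaces is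
  \<open>ae_eq_on S\<close>.
\<close>

definition ae_eq_on :: "(real^'d) set \<Rightarrow> (real^'d \<Rightarrow> real) \<Rightarrow> (real^'d \<Rightarrow> real) \<Rightarrow> bool" where
  "ae_eq_on S f g \<longleftrightarrow> (AE x in lebesgue_on S. f x = g x)"

definition L2_space :: "(real^'d) set \<Rightarrow> (real^'d \<Rightarrow> real) set" where
  "L2_space S = {f \<in> borel_measurable (lebesgue_on S). integrable (lebesgue_on S) (\<lambda>x. (f x)\<^sup>2)}"

definition Linf_space :: "(real^'d) set \<Rightarrow> (real^'d \<Rightarrow> real) set" where
  "Linf_space S = {f \<in> borel_measurable (lebesgue_on S). \<exists>C. AE x in lebesgue_on S. \<bar>f x\<bar> \<le> C}"

definition L2_norm_on :: "(real^'d) set \<Rightarrow> (real^'d \<Rightarrow> real) \<Rightarrow> real" where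
  "L2_norm_on S f = sqrt (LINT x|lebesgue_on S. (f x)\<^sup>2)"

definition function_subspace :: "('a \<Rightarrow> real) set \<Rightarrow> bool" where
  "function_subspace Q \<longleftrightarrow>
     (\<lambda>x. 0) \<in> Q \<and>
     (\<forall>f\<in>Q. \<forall>g\<in>Q. (\<lambda>x. f x + g x) \<in> Q) \<and>
     (\<forall>c. \<forall>f\<in>Q. (\<lambda>x. c * f x) \<in> Q)"

definition lin_comb :: "('n::finite \<Rightarrow> 'a \<Rightarrow> real) \<Rightarrow> real^'n \<Rightarrow> 'a \<Rightarrow> real" where
  "lin_comb \<psi> c = (\<lambda>x. \<Sum>j\<in>UNIV. c $ j * \<psi> j x)"

text \<open>A basis of \<open>Q\<close> viewed as a space of functions on \<open>S\<close> modulo equality almost everywhere.\<close>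

definition ae_basis_on ::
  "(real^'d) set \<Rightarrow> (real^'d \<Rightarrow> real) set \<Rightarrow> ('n::finite \<Rightarrow> real^'d \<Rightarrow> real) \<Rightarrow> bool" where
  "ae_basis_on S Q \<psi> \<longleftrightarrow>
     range \<psi> \<subseteq> Q \<and>
     (\<forall>c. ae_eq_on S (lin_comb \<psi> c) (\<lambda>x. 0) \<longrightarrow> c = 0) \<and>
     (\<forall>q\<in>Q. \<exists>c. ae_eq_on S q (lin_comb \<psi> c))"

definition sym_pos_def :: "real^'n^'n \<Rightarrow> bool" where
  "sym_pos_def A \<longleftrightarrow> transpose A = A \<and> (\<forall>x. x \<noteq> 0 \<longrightarrow> x \<bullet> (A *v x) > 0)"

definition objective ::
  "(real^'d) set \<Rightarrow> (real^'d \<Rightarrow> real) \<Rightarrow> (real^'d \<Rightarrow> real) \<Rightarrow> real \<Rightarrow> (real^'d \<Rightarrow> real) \<Rightarrow> real" where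
  "objective S u w \<alpha> q = (L2_norm_on S (\<lambda>x. w x + q x * u x))\<^sup>2 + \<alpha> * (L2_norm_on S q)\<^sup>2"

definition normal_matrix ::
  "(real^'d) set \<Rightarrow> (real^'d \<Rightarrow> real) \<Rightarrow> real \<Rightarrow> ('n::finite \<Rightarrow> real^'d \<Rightarrow> real) \<Rightarrow> real^'n^'n" where
  "normal_matrix S u \<alpha> \<psi> =
     (\<chi> i j. LINT x|lebesgue_on S. ((u x)\<^sup>2 + \<alpha>) * \<psi> i x * \<psi> j x)"

definition normal_rhs ::
  "(real^'d) set \<Rightarrow> (real^'d \<Rightarrow> real) \<Rightarrow> (real^'d \<Rightarrow> real) \<Rightarrow> ('n::finite \<Rightarrow> real^'d \<Rightarrow> real) \<Rightarrow> real^'n" where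
  "normal_rhs S u w \<psi> = (\<chi> i. - (LINT x|lebesgue_on S. w x * u x * \<psi> i x))"

end

theory Submission
  imports Defs
begin

text \<open>
  The objective is a quadratic functional whose quadratic part is the bilinear form
  \<open>B q \<phi> = \<integral> (u\<^sup>2 + \<alpha>) q \<phi>\<close>. It is positive definite modulo null functions because
  \<open>B q q \<ge> \<alpha> \<integral> q\<^sup>2\<close>. Expanding the objective around \<open>q\<close> shows that the minimizers are exactly
  the solutions of the normal equations, and in a basis these become a linear system with
  positive definite Gram matrix.
\<close>

section \<open>Square-integrable and essentially bounded functions\<close>

lemma L2_space_add:
  assumes "f \<in> L2_space S" "g \<in> L2_space S"
  shows "(\<lambda>x. f x + g x) \<in> L2_space S"
proof -
  have m: "f \<in> borel_measurable (lebesgue_on S)" "g \<in> borel_measurable (lebesgue_on S)"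
    and i: "integrable (lebesgue_on S) (\<lambda>x. (f x)\<^sup>2)" "integrable (lebesgue_on S) (\<lambda>x. (g x)\<^sup>2)"
    using assms by (auto simp: L2_space_def)
  have "(f x + g x)\<^sup>2 \<le> 2 * (f x)\<^sup>2 + 2 * (g x)\<^sup>2" for x
    using sum_squares_bound[of "f x" "g x"] by (simp add: power2_sum)
  then have "integrable (lebesgue_on S) (\<lambda>x. (f x + g x)\<^sup>2)"
    using i m by - (rule Bochner_Integration.integrable_bound
        [of _ "\<lambda>x. 2 * (f x)\<^sup>2 + 2 * (g x)\<^sup>2"], auto)
  then show ?thesis using m by (simp add: L2_space_def)
qed

lemma L2_space_mult_integrable:
  assumes "f \<in> L2_space S" "g \<in> L2_space S"
  shows "integrable (lebesgue_on S) (\<lambda>x. f x * g x)"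
proof -
  have m: "f \<in> borel_measurable (lebesgue_on S)" "g \<in> borel_measurable (lebesgue_on S)"
    and i: "integrable (lebesgue_on S) (\<lambda>x. (f x)\<^sup>2)" "integrable (lebesgue_on S) (\<lambda>x. (g x)\<^sup>2)"
    using assms by (auto simp: L2_space_def)
  \<comment> \<open>Pointwise AM-GM: twice the product of the absolute values is at most the
    right-hand side, and as that product is nonnegative, dropping the factor two only weakens the
    bound.\<close>
  have "\<bar>f x * g x\<bar> \<le> (f x)\<^sup>2 + (g x)\<^sup>2" for x
    using sum_squares_bound[of "\<bar>f x\<bar>" "\<bar>g x\<bar>"] mult_nonneg_nonneg[of "\<bar>f x\<bar>" "\<bar>g x\<bar>"]
    by (simp only: abs_mult power2_abs, linarith)
  then show ?thesis
    using i m by - (rule Bochner_Integration.integrable_bound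
        [of _ "\<lambda>x. (f x)\<^sup>2 + (g x)\<^sup>2"], auto)
qed

lemma Linf_mult_L2_space:
  assumes "u \<in> Linf_space S" "f \<in> L2_space S"
  shows "(\<lambda>x. u x * f x) \<in> L2_space S"
proof -
  obtain C where C: "AE x in lebesgue_on S. \<bar>u x\<bar> \<le> C"
    and m: "u \<in> borel_measurable (lebesgue_on S)"
    using assms(1) by (auto simp: Linf_space_def)
  have m': "f \<in> borel_measurable (lebesgue_on S)"
    and i: "integrable (lebesgue_on S) (\<lambda>x. (f x)\<^sup>2)"
    using assms(2) by (auto simp: L2_space_def)
  have "AE x in lebesgue_on S. norm ((u x * f x)\<^sup>2) \<le> norm (C\<^sup>2 * (f x)\<^sup>2)"
    using C
  proof eventually_elim
    case (elim x)
    then have "(u x)\<^sup>2 \<le> C\<^sup>2"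
      using power_mono[of "\<bar>u x\<bar>" C 2] by simp
    then show ?case by (simp add: power_mult_distrib mult_right_mono)
  qed
  then have "integrable (lebesgue_on S) (\<lambda>x. (u x * f x)\<^sup>2)"
    using i m m' by - (rule Bochner_Integration.integrable_bound
        [of _ "\<lambda>x. C\<^sup>2 * (f x)\<^sup>2"], auto)
  then show ?thesis using m m' by (simp add: L2_space_def)
qed

lemma L2_norm_on_squared: "(L2_norm_on S f)\<^sup>2 = (LINT x|lebesgue_on S. (f x)\<^sup>2)"
  by (simp add: L2_norm_on_def)

text \<open>The bound comes from the compact set \<open>K\<close>, since \<open>S\<close> may be
  open; finite measure of \<open>S\<close> then turns boundedness into square integrability.\<close>

lemma continuous_on_compact_imp_Linf_L2:
  fixes f :: "real^'d \<Rightarrow> real"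
  assumes "continuous_on K f" "compact K" "S \<subseteq> K" "S \<in> lmeasurable"
  shows "f \<in> Linf_space S" "f \<in> L2_space S"
proof -
  have S: "S \<in> sets lebesgue" using assms(4) by blast
  have m: "f \<in> borel_measurable (lebesgue_on S)"
    using assms(1,3) S by (blast intro: continuous_imp_measurable_on_sets_lebesgue continuous_on_subset)
  obtain C where C: "\<forall>x\<in>K. norm (f x) \<le> C"
    using compact_imp_bounded[OF compact_continuous_image[OF assms(1,2)]]
    by (auto simp: bounded_iff)
  have AE: "AE x in lebesgue_on S. \<bar>f x\<bar> \<le> C"
    using C assms(3) by (intro AE_I2) auto
  show Linf: "f \<in> Linf_space S" using m AE by (auto simp: Linf_space_def)
  interpret finite_measure "lebesgue_on S"
    using assms(4) by (rule finite_measure_lebesgue_on)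
  \<comment> \<open>Finite measure enters here: constants are square integrable, and
    \<open>f\<close> is the bounded function \<open>f\<close> times the constant one.\<close>
  have "(\<lambda>x. 1) \<in> L2_space S" by (simp add: L2_space_def)
  from Linf_mult_L2_space[OF Linf this] show "f \<in> L2_space S" by simp
qed

section \<open>Linear combinations, bases modulo null sets, and elementary algebra\<close>

lemma function_subspace_lin_comb:
  assumes "function_subspace Q" "range \<psi> \<subseteq> Q"
  shows "lin_comb \<psi> c \<in> Q"
proof -
  have "(\<lambda>x. \<Sum>j\<in>J. c $ j * \<psi> j x) \<in> Q" if "finite J" for J
    using that
  proof induction
    case empty
    then show ?case using assms(1) by (simp add: function_subspace_def)
  next
    case (insert j J)
    moreover have "(\<lambda>x. c $ j * \<psi> j x) \<in> Q"
      using assms unfolding function_subspace_def by blast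
    ultimately show ?case
      using assms(1) by (simp add: function_subspace_def)
  qed
  then show ?thesis by (simp add: lin_comb_def)
qed

lemma lin_comb_diff: "lin_comb \<psi> (c - d) x = lin_comb \<psi> c x - lin_comb \<psi> d x"
  by (simp add: lin_comb_def left_diff_distrib sum_subtractf)

lemma ae_basis_on_coordinates_unique:
  assumes "ae_basis_on S Q \<psi>" "ae_eq_on S q (lin_comb \<psi> c)"
  shows "ae_eq_on S q (lin_comb \<psi> d) \<longleftrightarrow> d = c"
proof
  assume "ae_eq_on S q (lin_comb \<psi> d)"
  then have "ae_eq_on S (lin_comb \<psi> (d - c)) (\<lambda>x. 0)"
    using assms(2) unfolding ae_eq_on_def by eventually_elim (simp add: lin_comb_diff)
  then have "d - c = 0" using assms(1) unfolding ae_basis_on_def by blast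
  then show "d = c" by simp
qed (use assms(2) in simp)

text \<open>A kernel vector \<open>x\<close> gives \<open>x \<bullet> (A *v x) = 0\<close>, so it
  must be zero; for a square matrix a trivial kernel suffices.\<close>

lemma sym_pos_def_invertible:
  assumes "sym_pos_def (A :: real^'n^'n)"
  shows "invertible A"
proof -
  have "x = 0" if "A *v x = 0" for x
    using assms that by (metis sym_pos_def_def inner_zero_right less_irrefl)
  then show ?thesis
    by (simp add: invertible_left_inverse matrix_left_invertible_ker)
qed

text \<open>For small \<open>t\<close> of sign opposite to \<open>a\<close>, the linear term
  dominates and is negative. This extracts the first-order optimality condition from minimality
  along a line.\<close>

lemma linear_le_quadratic_imp_zero:
  fixes a b :: real
  assumes "\<And>t. 0 \<le> t * a + t\<^sup>2 * b"
  shows "a = 0"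
proof (rule ccontr)
  assume "a \<noteq> 0"
  \<comment> \<open>A step size short enough that \<open>s * b < 1\<close> whatever the sign of
    \<open>b\<close>; the test point is \<open>t = - s * a\<close>.\<close>
  define s where "s = 1 / (\<bar>b\<bar> + 1)"
  have s: "s > 0" "s * b < 1" by (auto simp: s_def divide_simps)
  have "(- s * a) * a + (- s * a)\<^sup>2 * b = s * a\<^sup>2 * (s * b - 1)"
    by (simp add: power2_eq_square algebra_simps)
  also have "\<dots> < 0"
    using s \<open>a \<noteq> 0\<close> by (intro mult_pos_neg) auto
  finally show False using assms[of "- s * a"] by simp
qed

section \<open>The bilinear form and the linear functional of the normal equations\<close>

text \<open>The quadratic problem in the abstract: boundedness of \<open>u\<close> keeps
  \<open>u q\<close> square integrable, so every integral below exists. Finite dimension enters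
  later, with a basis, to obtain existence.\<close>

locale regularized_least_squares =
  fixes S :: "(real^'d) set" and u w :: "real^'d \<Rightarrow> real" and \<alpha> :: real
    and Q :: "(real^'d \<Rightarrow> real) set"
  assumes u_Linf: "u \<in> Linf_space S"
    and w_L2: "w \<in> L2_space S"
    and alpha_pos: "\<alpha> > 0"
    and Q_L2: "Q \<subseteq> L2_space S"
    and Q_subspace: "function_subspace Q"
begin

definition normal_form :: "(real^'d \<Rightarrow> real) \<Rightarrow> (real^'d \<Rightarrow> real) \<Rightarrow> real" where
  "normal_form q \<phi> = (LINT x|lebesgue_on S. ((u x)\<^sup>2 + \<alpha>) * q x * \<phi> x)"

definition normal_functional :: "(real^'d \<Rightarrow> real) \<Rightarrow> real" where
  "normal_functional \<phi> = - (LINT x|lebesgue_on S. w x * u x * \<phi> x)"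

lemma normal_form_integrable:
  assumes "q \<in> L2_space S" "\<phi> \<in> L2_space S"
  shows "integrable (lebesgue_on S) (\<lambda>x. ((u x)\<^sup>2 + \<alpha>) * q x * \<phi> x)"
proof -
  \<comment> \<open>The weight \<open>u\<^sup>2\<close> is shared between the two factors, so that
    each summand is a product of two square-integrable functions.\<close>
  have "integrable (lebesgue_on S) (\<lambda>x. (u x * q x) * (u x * \<phi> x) + \<alpha> * (q x * \<phi> x))"
    using assms u_Linf
    by (intro Bochner_Integration.integrable_add integrable_mult_right
        L2_space_mult_integrable Linf_mult_L2_space)
  then show ?thesis by (simp add: power2_eq_square algebra_simps)
qed

lemma normal_functional_integrable:
  assumes "\<phi> \<in> L2_space S"
  shows "integrable (lebesgue_on S) (\<lambda>x. w x * u x * \<phi> x)"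
  using L2_space_mult_integrable[OF w_L2 Linf_mult_L2_space[OF u_Linf assms]]
  by (simp add: mult.assoc)

lemma normal_form_commute: "normal_form q \<phi> = normal_form \<phi> q"
  by (simp add: normal_form_def mult_ac)

lemma normal_form_cmult_right: "normal_form q (\<lambda>x. t * \<phi> x) = t * normal_form q \<phi>"
proof -
  have "normal_form q (\<lambda>x. t * \<phi> x)
      = (LINT x|lebesgue_on S. t * (((u x)\<^sup>2 + \<alpha>) * q x * \<phi> x))"
    unfolding normal_form_def by (intro Bochner_Integration.integral_cong) (auto simp: mult_ac)
  then show ?thesis by (simp add: normal_form_def)
qed

lemma normal_functional_cmult: "normal_functional (\<lambda>x. t * \<phi> x) = t * normal_functional \<phi>"
proof -
  have "normal_functional (\<lambda>x. t * \<phi> x) = - (LINT x|lebesgue_on S. t * (w x * u x * \<phi> x))"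
    unfolding normal_functional_def
    by (intro arg_cong[where f = uminus] Bochner_Integration.integral_cong) (auto simp: mult_ac)
  then show ?thesis by (simp add: normal_functional_def)
qed

text \<open>Elements of \<open>Q\<close> agree with their basis expansions only almost everywhere;
  this allows one to be exchanged for the other.\<close>

lemma normal_form_cong_AE:
  assumes "ae_eq_on S \<phi> \<phi>'" "q \<in> L2_space S" "\<phi> \<in> L2_space S" "\<phi>' \<in> L2_space S"
  shows "normal_form q \<phi> = normal_form q \<phi>'"
  unfolding normal_form_def
proof (rule integral_cong_AE)
  show "AE x in lebesgue_on S. ((u x)\<^sup>2 + \<alpha>) * q x * \<phi> x = ((u x)\<^sup>2 + \<alpha>) * q x * \<phi>' x"
    using assms(1) unfolding ae_eq_on_def by eventually_elim simp
qed (intro borel_measurable_integrable normal_form_integrable assms)+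

lemma normal_functional_cong_AE:
  assumes "ae_eq_on S \<phi> \<phi>'" "\<phi> \<in> L2_space S" "\<phi>' \<in> L2_space S"
  shows "normal_functional \<phi> = normal_functional \<phi>'"
  unfolding normal_functional_def
proof (intro arg_cong[where f = uminus] integral_cong_AE)
  show "AE x in lebesgue_on S. w x * u x * \<phi> x = w x * u x * \<phi>' x"
    using assms(1) unfolding ae_eq_on_def by eventually_elim simp
qed (intro borel_measurable_integrable normal_functional_integrable assms)+

lemma normal_form_nonneg: "0 \<le> normal_form q q"
  unfolding normal_form_def using alpha_pos
  by (intro Bochner_Integration.integral_nonneg) (simp add: mult.assoc)

text \<open>A nonnegative integrand with zero integral vanishes almost everywhere, and the weight is
  at least \<alpha> > 0 even where \<open>u\<close> vanishes, so \<open>q\<close> itself must be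
  zero there.\<close>

lemma normal_form_eq_0_imp:
  assumes "q \<in> L2_space S" "normal_form q q = 0"
  shows "ae_eq_on S q (\<lambda>x. 0)"
proof -
  have "AE x in lebesgue_on S. ((u x)\<^sup>2 + \<alpha>) * q x * q x = 0"
    using assms alpha_pos normal_form_integrable[OF assms(1,1)]
    by (subst integral_nonneg_eq_0_iff_AE[symmetric]) (auto simp: normal_form_def mult.assoc)
  moreover have "(u x)\<^sup>2 + \<alpha> \<noteq> 0" for x
    using alpha_pos by (simp add: add_nonneg_pos less_imp_neq[symmetric])
  ultimately show ?thesis by (simp add: ae_eq_on_def)
qed

lemma normal_form_lin_comb_right:
  assumes "q \<in> L2_space S" "range \<psi> \<subseteq> L2_space S"
  shows "normal_form q (lin_comb \<psi> d) = (\<Sum>j\<in>UNIV. d $ j * normal_form q (\<psi> j))"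
proof -
  have "normal_form q (lin_comb \<psi> d)
      = (LINT x|lebesgue_on S. (\<Sum>j\<in>UNIV. d $ j * (((u x)\<^sup>2 + \<alpha>) * q x * \<psi> j x)))"
    unfolding normal_form_def lin_comb_def
    by (intro Bochner_Integration.integral_cong) (auto simp: sum_distrib_left mult_ac)
  also have "\<dots> = (\<Sum>j\<in>UNIV. LINT x|lebesgue_on S. d $ j * (((u x)\<^sup>2 + \<alpha>) * q x * \<psi> j x))"
    using assms
    by (intro Bochner_Integration.integral_sum integrable_mult_right normal_form_integrable) auto
  finally show ?thesis by (simp add: normal_form_def)
qed

lemma normal_functional_lin_comb:
  assumes "range \<psi> \<subseteq> L2_space S"
  shows "normal_functional (lin_comb \<psi> d) = d \<bullet> normal_rhs S u w \<psi>"
proof -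
  have "normal_functional (lin_comb \<psi> d)
      = - (LINT x|lebesgue_on S. (\<Sum>j\<in>UNIV. d $ j * (w x * u x * \<psi> j x)))"
    unfolding normal_functional_def lin_comb_def
    by (intro arg_cong[where f = uminus] Bochner_Integration.integral_cong)
      (auto simp: sum_distrib_left mult_ac)
  also have "\<dots> = - (\<Sum>j\<in>UNIV. LINT x|lebesgue_on S. d $ j * (w x * u x * \<psi> j x))"
    using assms
    by (subst Bochner_Integration.integral_sum)
      (auto intro!: integrable_mult_right normal_functional_integrable)
  finally show ?thesis
    by (simp add: normal_rhs_def inner_vec_def sum_negf)
qed

text \<open>Identifies \<open>normal_matrix\<close> as the Gram matrix of
  \<open>normal_form\<close>.\<close>

lemma normal_form_lin_comb_lin_comb:
  assumes "range \<psi> \<subseteq> L2_space S" "lin_comb \<psi> c \<in> L2_space S"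
  shows "normal_form (lin_comb \<psi> c) (lin_comb \<psi> d) = d \<bullet> (normal_matrix S u \<alpha> \<psi> *v c)"
proof -
  have "normal_form (lin_comb \<psi> c) (\<psi> j) = (normal_matrix S u \<alpha> \<psi> *v c) $ j" for j
  proof -
    \<comment> \<open>Linearity has been shown in the second argument, so symmetry moves the
      combination there first.\<close>
    have "normal_form (lin_comb \<psi> c) (\<psi> j) = (\<Sum>i\<in>UNIV. c $ i * normal_form (\<psi> j) (\<psi> i))"
      using assms(1) by (subst normal_form_commute, subst normal_form_lin_comb_right) auto
    then show ?thesis
      by (simp add: matrix_vector_mult_def normal_matrix_def normal_form_def mult_ac)
  qed
  then show ?thesis
    using assms by (simp add: normal_form_lin_comb_right inner_vec_def)
qed

section \<open>Minimizers and the normal equations\<close>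

text \<open>An exact second-order Taylor expansion, without remainder because the objective is
  quadratic; the middle term is the directional derivative at \<open>q\<close>.\<close>

lemma objective_add:
  assumes q: "q \<in> L2_space S" and \<phi>: "\<phi> \<in> L2_space S"
  shows "objective S u w \<alpha> (\<lambda>x. q x + \<phi> x) =
    objective S u w \<alpha> q + 2 * (normal_form q \<phi> - normal_functional \<phi>) + normal_form \<phi> \<phi>"
proof -
  have sq: "integrable (lebesgue_on S) (\<lambda>x. (w x + f x * u x)\<^sup>2)"
    "integrable (lebesgue_on S) (\<lambda>x. \<alpha> * (f x)\<^sup>2)" if "f \<in> L2_space S" for f
    using L2_space_add[OF w_L2 Linf_mult_L2_space[OF u_Linf that]] that
    by (auto simp: L2_space_def mult.commute)
  \<comment> \<open>Integrability of both squares lets the two norms merge into one integral, which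
    reduces the expansion to a pointwise identity.\<close>
  have obj: "objective S u w \<alpha> f = (LINT x|lebesgue_on S. (w x + f x * u x)\<^sup>2 + \<alpha> * (f x)\<^sup>2)"
    if "f \<in> L2_space S" for f
    using sq[OF that] by (simp add: objective_def L2_norm_on_squared)
  note int = sq[OF q] normal_form_integrable[OF q \<phi>] normal_functional_integrable[OF \<phi>]
    normal_form_integrable[OF \<phi> \<phi>]
  have "objective S u w \<alpha> (\<lambda>x. q x + \<phi> x) =
    (LINT x|lebesgue_on S. ((w x + q x * u x)\<^sup>2 + \<alpha> * (q x)\<^sup>2)
       + 2 * (((u x)\<^sup>2 + \<alpha>) * q x * \<phi> x + w x * u x * \<phi> x) + ((u x)\<^sup>2 + \<alpha>) * \<phi> x * \<phi> x)"
    unfolding obj[OF L2_space_add[OF q \<phi>]]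
    by (intro Bochner_Integration.integral_cong) (auto simp: power2_eq_square algebra_simps)
  also have "\<dots> = objective S u w \<alpha> q + 2 * (normal_form q \<phi> - normal_functional \<phi>) + normal_form \<phi> \<phi>"
    using int by (simp add: obj[OF q] normal_form_def normal_functional_def)
  finally show ?thesis .
qed

lemma Q_diff:
  assumes "q \<in> Q" "q' \<in> Q"
  shows "(\<lambda>x. q' x - q x) \<in> Q"
proof -
  have add: "\<And>f g. f \<in> Q \<Longrightarrow> g \<in> Q \<Longrightarrow> (\<lambda>x. f x + g x) \<in> Q"
    and cmult: "\<And>c f. f \<in> Q \<Longrightarrow> (\<lambda>x. c * f x) \<in> Q"
    using Q_subspace by (auto simp: function_subspace_def)
  show ?thesis using add[OF assms(2) cmult[OF assms(1), of "- 1"]] by simp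
qed

text \<open>The direction from \<open>q\<close> to \<open>q'\<close> lies in \<open>Q\<close>, so
  the linear term of the expansion vanishes and only the energy of the difference remains.\<close>

lemma objective_eq_of_normal_equations:
  assumes "q \<in> Q" "\<forall>\<phi>\<in>Q. normal_form q \<phi> = normal_functional \<phi>" "q' \<in> Q"
  shows "objective S u w \<alpha> q' =
    objective S u w \<alpha> q + normal_form (\<lambda>x. q' x - q x) (\<lambda>x. q' x - q x)"
proof -
  have d: "(\<lambda>x. q' x - q x) \<in> Q" using assms by (intro Q_diff)
  then show ?thesis
    using objective_add[of q "\<lambda>x. q' x - q x"] bspec[OF assms(2) d] assms(1) Q_L2
    by (simp add: subsetD)
qed

text \<open>Forwards, the objective is tested along lines through \<open>q\<close>; backwards, the
  excess over the value at \<open>q\<close> is a nonnegative energy.\<close>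

lemma is_arg_min_iff_normal_equations:
  assumes "q \<in> Q"
  shows "is_arg_min (objective S u w \<alpha>) (\<lambda>q. q \<in> Q) q \<longleftrightarrow>
    (\<forall>\<phi>\<in>Q. normal_form q \<phi> = normal_functional \<phi>)"
proof (intro iffI ballI)
  fix \<phi>
  assume min: "is_arg_min (objective S u w \<alpha>) (\<lambda>q. q \<in> Q) q" and \<phi>: "\<phi> \<in> Q"
  \<comment> \<open>The increase of the objective from \<open>q\<close> to
    \<open>q + t \<phi>\<close>, as a polynomial in \<open>t\<close> without constant term.\<close>
  have "0 \<le> t * (2 * (normal_form q \<phi> - normal_functional \<phi>)) + t\<^sup>2 * normal_form \<phi> \<phi>" for t
  proof -
    have t\<phi>: "(\<lambda>x. t * \<phi> x) \<in> Q"
      using Q_subspace \<phi> by (simp add: function_subspace_def)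
    then have "(\<lambda>x. q x + t * \<phi> x) \<in> Q"
      using Q_subspace assms by (simp add: function_subspace_def)
    then have "objective S u w \<alpha> q \<le> objective S u w \<alpha> (\<lambda>x. q x + t * \<phi> x)"
      using min by (auto simp: is_arg_min_linorder)
    moreover have "normal_form (\<lambda>x. t * \<phi> x) (\<lambda>x. t * \<phi> x) = t\<^sup>2 * normal_form \<phi> \<phi>"
      by (simp add: normal_form_cmult_right normal_form_commute[of "\<lambda>x. t * \<phi> x"] power2_eq_square)
    ultimately show ?thesis
      using objective_add[of q "\<lambda>x. t * \<phi> x"] assms t\<phi> Q_L2
      by (auto simp: subset_iff normal_form_cmult_right normal_functional_cmult algebra_simps)
  qed
  then have "2 * (normal_form q \<phi> - normal_functional \<phi>) = 0"
    by (rule linear_le_quadratic_imp_zero)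
  then show "normal_form q \<phi> = normal_functional \<phi>" by simp
next
  assume eq: "\<forall>\<phi>\<in>Q. normal_form q \<phi> = normal_functional \<phi>"
  have "objective S u w \<alpha> q \<le> objective S u w \<alpha> q'" if "q' \<in> Q" for q'
    unfolding objective_eq_of_normal_equations[OF assms eq that]
    using normal_form_nonneg by simp
  then show "is_arg_min (objective S u w \<alpha>) (\<lambda>q. q \<in> Q) q"
    using assms by (simp add: is_arg_min_linorder)
qed

text \<open>Both minimizers have the same value, so their difference has zero energy and is a null
  function.\<close>

lemma is_arg_min_unique:
  assumes "is_arg_min (objective S u w \<alpha>) (\<lambda>q. q \<in> Q) q"
    and "is_arg_min (objective S u w \<alpha>) (\<lambda>q. q \<in> Q) q'"
  shows "ae_eq_on S q q'"
proof -
  have Q: "q \<in> Q" "q' \<in> Q" and le: "objective S u w \<alpha> q' \<le> objective S u w \<alpha> q"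
    using assms by (auto simp: is_arg_min_linorder)
  have "objective S u w \<alpha> q' =
      objective S u w \<alpha> q + normal_form (\<lambda>x. q' x - q x) (\<lambda>x. q' x - q x)"
    using Q assms(1) is_arg_min_iff_normal_equations objective_eq_of_normal_equations by blast
  then have "normal_form (\<lambda>x. q' x - q x) (\<lambda>x. q' x - q x) = 0"
    using le normal_form_nonneg[of "\<lambda>x. q' x - q x"] by linarith
  then have "ae_eq_on S (\<lambda>x. q' x - q x) (\<lambda>x. 0)"
    using Q_diff[OF Q] Q_L2 by (intro normal_form_eq_0_imp) auto
  then show ?thesis unfolding ae_eq_on_def by eventually_elim simp
qed

section \<open>Coordinates in a basis and the linear system\<close>

context
  fixes \<psi> :: "'n::finite \<Rightarrow> real^'d \<Rightarrow> real"
  assumes basis: "ae_basis_on S Q \<psi>"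
begin

lemma range_basis: "range \<psi> \<subseteq> Q"
  using basis by (simp add: ae_basis_on_def)

lemma lin_comb_in_Q: "lin_comb \<psi> c \<in> Q"
  using Q_subspace range_basis by (rule function_subspace_lin_comb)

lemma normal_form_lin_comb_basis:
  "normal_form (lin_comb \<psi> c) (lin_comb \<psi> d) = d \<bullet> (normal_matrix S u \<alpha> \<psi> *v c)"
  using lin_comb_in_Q range_basis Q_L2 by (intro normal_form_lin_comb_lin_comb) auto

lemma normal_functional_lin_comb_basis:
  "normal_functional (lin_comb \<psi> d) = d \<bullet> normal_rhs S u w \<psi>"
  using range_basis Q_L2 by (intro normal_functional_lin_comb) auto

text \<open>Linear independence modulo null sets makes the combination with coefficients
  \<open>c\<close> non-null, hence of positive energy; that energy is the quadratic form of the
  matrix at \<open>c\<close>.\<close>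

lemma sym_pos_def_normal_matrix: "sym_pos_def (normal_matrix S u \<alpha> \<psi>)"
  unfolding sym_pos_def_def
proof (intro conjI allI impI)
  show "transpose (normal_matrix S u \<alpha> \<psi>) = normal_matrix S u \<alpha> \<psi>"
    by (simp add: normal_matrix_def transpose_def vec_eq_iff mult_ac)
next
  fix c :: "real^'n"
  assume "c \<noteq> 0"
  then have "\<not> ae_eq_on S (lin_comb \<psi> c) (\<lambda>x. 0)"
    using basis unfolding ae_basis_on_def by blast
  then have "normal_form (lin_comb \<psi> c) (lin_comb \<psi> c) \<noteq> 0"
    using normal_form_eq_0_imp lin_comb_in_Q Q_L2 by blast
  then show "c \<bullet> (normal_matrix S u \<alpha> \<psi> *v c) > 0"
    using normal_form_nonneg[of "lin_comb \<psi> c"] by (simp add: normal_form_lin_comb_basis)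
qed

text \<open>Testing with \<phi> of coordinates \<open>d\<close> gives the system paired with
  \<open>d\<close>. As \<phi> runs through \<open>Q\<close>, \<open>d\<close> runs through all
  vectors.\<close>

lemma normal_equations_iff_linear_system:
  assumes q: "q \<in> Q" "ae_eq_on S q (lin_comb \<psi> c)"
  shows "(\<forall>\<phi>\<in>Q. normal_form q \<phi> = normal_functional \<phi>) \<longleftrightarrow>
    normal_matrix S u \<alpha> \<psi> *v c = normal_rhs S u w \<psi>"
proof -
  have L2: "f \<in> Q \<Longrightarrow> f \<in> L2_space S" for f using Q_L2 by blast
  have eq: "normal_form q \<phi> = d \<bullet> (normal_matrix S u \<alpha> \<psi> *v c)"
      "normal_functional \<phi> = d \<bullet> normal_rhs S u w \<psi>"
    if \<phi>: "\<phi> \<in> Q" "ae_eq_on S \<phi> (lin_comb \<psi> d)" for \<phi> d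
  proof -
    \<comment> \<open>The congruence rule acts on the second argument, hence the flip of both
      sides.\<close>
    have "normal_form q \<phi> = normal_form (lin_comb \<psi> c) \<phi>"
      using q \<phi>(1) lin_comb_in_Q L2
      by (subst (1 2) normal_form_commute) (intro normal_form_cong_AE, auto)
    also have "\<dots> = normal_form (lin_comb \<psi> c) (lin_comb \<psi> d)"
      using \<phi> lin_comb_in_Q L2 by (intro normal_form_cong_AE) auto
    finally show "normal_form q \<phi> = d \<bullet> (normal_matrix S u \<alpha> \<psi> *v c)"
      by (simp add: normal_form_lin_comb_basis)
    show "normal_functional \<phi> = d \<bullet> normal_rhs S u w \<psi>"
      using normal_functional_cong_AE[OF \<phi>(2)] \<phi>(1) lin_comb_in_Q L2
      by (simp add: normal_functional_lin_comb_basis)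
  qed
  show ?thesis
  proof
    assume ne: "\<forall>\<phi>\<in>Q. normal_form q \<phi> = normal_functional \<phi>"
    show "normal_matrix S u \<alpha> \<psi> *v c = normal_rhs S u w \<psi>"
    proof (rule vector_eq_rdot[THEN iffD1], intro allI)
      fix d
      have "ae_eq_on S (lin_comb \<psi> d) (lin_comb \<psi> d)" by (simp add: ae_eq_on_def)
      then show "(normal_matrix S u \<alpha> \<psi> *v c) \<bullet> d = normal_rhs S u w \<psi> \<bullet> d"
        using eq[OF lin_comb_in_Q] ne lin_comb_in_Q by (metis inner_commute)
    qed
  next
    assume sys: "normal_matrix S u \<alpha> \<psi> *v c = normal_rhs S u w \<psi>"
    show "\<forall>\<phi>\<in>Q. normal_form q \<phi> = normal_functional \<phi>"
    proof
      fix \<phi>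
      assume \<phi>: "\<phi> \<in> Q"
      then obtain d where "ae_eq_on S \<phi> (lin_comb \<psi> d)"
        using basis unfolding ae_basis_on_def by blast
      from eq[OF \<phi> this] sys show "normal_form q \<phi> = normal_functional \<phi>" by simp
    qed
  qed
qed

lemma normal_matrix_unique_solution:
  "normal_matrix S u \<alpha> \<psi> *v c = normal_matrix S u \<alpha> \<psi> *v d \<longleftrightarrow> c = d"
  using inj_matrix_vector_mult[OF sym_pos_def_invertible[OF sym_pos_def_normal_matrix]]
  by (auto dest: injD)

text \<open>Existence by linear algebra: the invertible system is solved, and its solution gives a
  function satisfying the normal equations.\<close>

lemma ex_is_arg_min: "\<exists>q. is_arg_min (objective S u w \<alpha>) (\<lambda>q. q \<in> Q) q"
proof -
  obtain B where "normal_matrix S u \<alpha> \<psi> ** B = mat 1"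
    using sym_pos_def_invertible[OF sym_pos_def_normal_matrix] unfolding invertible_def by blast
  then obtain c where "normal_matrix S u \<alpha> \<psi> *v c = normal_rhs S u w \<psi>"
    by (metis matrix_vector_mul_assoc matrix_vector_mul_lid)
  then have "\<forall>\<phi>\<in>Q. normal_form (lin_comb \<psi> c) \<phi> = normal_functional \<phi>"
    using normal_equations_iff_linear_system[OF lin_comb_in_Q, of c c]
    by (simp add: ae_eq_on_def)
  then show ?thesis
    using is_arg_min_iff_normal_equations[OF lin_comb_in_Q] by blast
qed

text \<open>One \<open>c\<close> serves both equivalences: the coordinate vector is unique, the
  solution of the system is unique, and the two coincide.\<close>

lemma is_arg_min_coordinates:
  assumes min: "is_arg_min (objective S u w \<alpha>) (\<lambda>q. q \<in> Q) q"
  shows "\<exists>c. (\<forall>c'. ae_eq_on S q (lin_comb \<psi> c') \<longleftrightarrow> c' = c) \<and>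
    (\<forall>c'. normal_matrix S u \<alpha> \<psi> *v c' = normal_rhs S u w \<psi> \<longleftrightarrow> c' = c)"
proof -
  have q: "q \<in> Q" using min by (simp add: is_arg_min_def)
  then obtain c where c: "ae_eq_on S q (lin_comb \<psi> c)"
    using basis unfolding ae_basis_on_def by blast
  have "normal_matrix S u \<alpha> \<psi> *v c = normal_rhs S u w \<psi>"
    using is_arg_min_iff_normal_equations[OF q] normal_equations_iff_linear_system[OF q c] min
    by blast
  then show ?thesis
    using ae_basis_on_coordinates_unique[OF basis c] normal_matrix_unique_solution[of _ c]
    by (intro exI[of _ c]) simp
qed

end

end

section \<open>Application to finite element functions\<close>

theorem theorem3p12:
  fixes \<Omega> \<Omega>' :: "(real^'d) set" and R :: real
    and \<T> :: "(real^'d) set set" and p :: nat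
    and u w :: "real^'d \<Rightarrow> real"
    and Q :: "(real^'d \<Rightarrow> real) set"
    and \<psi> :: "'n::finite \<Rightarrow> real^'d \<Rightarrow> real"
    and \<alpha>\<^sub>q :: real
  assumes "bounded_lipschitz_domain \<Omega>"
    and "interior_subdomain \<Omega>' \<Omega>"
    and "\<Omega> \<subseteq> cube R"
    and "mesh_of (cube R) \<T>"
    and "p \<ge> 1"
    and "u \<in> fe_space (cube R) \<T> p"
    and "w \<in> fe_space_0 (cube R) \<T> p \<Omega>"
    and "Q \<subseteq> Linf_space \<Omega>' \<inter> L2_space \<Omega>'"
    and "function_subspace Q"
    and "ae_basis_on \<Omega>' Q \<psi>"
    and "\<alpha>\<^sub>q > 0"
  shows
    "(\<exists>q. is_arg_min (objective \<Omega>' u w \<alpha>\<^sub>q) (\<lambda>q. q \<in> Q) q) \<and>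
     (\<forall>q q'. is_arg_min (objective \<Omega>' u w \<alpha>\<^sub>q) (\<lambda>q. q \<in> Q) q \<and>
             is_arg_min (objective \<Omega>' u w \<alpha>\<^sub>q) (\<lambda>q. q \<in> Q) q' \<longrightarrow> ae_eq_on \<Omega>' q q') \<and>
     (\<forall>q\<in>Q. is_arg_min (objective \<Omega>' u w \<alpha>\<^sub>q) (\<lambda>q. q \<in> Q) q \<longleftrightarrow>
        (\<forall>\<phi>\<in>Q. (LINT x|lebesgue_on \<Omega>'. ((u x)\<^sup>2 + \<alpha>\<^sub>q) * q x * \<phi> x) =
                - (LINT x|lebesgue_on \<Omega>'. w x * u x * \<phi> x))) \<and>
     sym_pos_def (normal_matrix \<Omega>' u \<alpha>\<^sub>q \<psi>) \<and>
     (\<forall>q. is_arg_min (objective \<Omega>' u w \<alpha>\<^sub>q) (\<lambda>q. q \<in> Q) q \<longrightarrow>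
        (\<exists>c. (\<forall>c'. ae_eq_on \<Omega>' q (lin_comb \<psi> c') \<longleftrightarrow> c' = c) \<and>
             (\<forall>c'. normal_matrix \<Omega>' u \<alpha>\<^sub>q \<psi> *v c' = normal_rhs \<Omega>' u w \<psi> \<longleftrightarrow> c' = c)))"
proof -
  \<comment> \<open>Finite element functions are continuous on the open cube; the closure of the
    interior subdomain is a compact subset of it, which supplies the bounds.\<close>
  let ?K = "closure \<Omega>'"
  have K: "compact ?K" "?K \<subseteq> cube R" and "open \<Omega>'"
    using assms(2,3) by (auto simp: interior_subdomain_def)
  have S: "\<Omega>' \<in> lmeasurable"
    using \<open>open \<Omega>'\<close> compact_imp_bounded[OF K(1)] closure_subset
    by (blast intro: lmeasurable_open bounded_subset)
  have cont: "continuous_on ?K u" "continuous_on ?K w"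
    using assms(6,7) K(2) by (auto simp: fe_space_def fe_space_0_def intro: continuous_on_subset)
  interpret regularized_least_squares \<Omega>' u w \<alpha>\<^sub>q Q
    using assms(8,9,11) continuous_on_compact_imp_Linf_L2[OF cont(1) K(1) closure_subset S]
      continuous_on_compact_imp_Linf_L2[OF cont(2) K(1) closure_subset S]
    by unfold_locales auto
  \<comment> \<open>Unfolded to the explicit integrals in which the conclusion is phrased.\<close>
  note normal_eqs = is_arg_min_iff_normal_equations
    [unfolded normal_form_def normal_functional_def]
  show ?thesis
    using ex_is_arg_min[OF assms(10)] is_arg_min_unique normal_eqs
      sym_pos_def_normal_matrix[OF assms(10)] is_arg_min_coordinates[OF assms(10)]
    by blast
qed

end
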